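(* For each integer $k \ge 5$, there is an infinite family $\mathcal{G}_k$ of $k$-regular graphs such that every $G\in\mathcal{G}_k$ satisfies $\gamma_I^p(G)=|V(G)|$; in particular, the best constant $c$ such that $\gamma_I^p(G)\le c\,|V(G)|$ for all $G\in\mathcal{G}_k$ is $c=1$.
   Context: All graphs are finite, simple and undirected (not necessarily connected). For a graph $G=(V,E)$ and $v\in V$, $N(v)$ denotes the set of neighbours of $v$. A perfect Italian dominating function (PID-function) of $G$ is a function $f:V\to\{0,1,2\}$ such that for every vertex $v$ with $f(v)=0$ one has $\sum_{u\in N(v)} f(u)=2$. The weight of $f$ is $\sum_{v\in V} f(v)$. The perfect Italian domination number $\gamma_I^p(G)$ is the minimum weight of a PID-function of $G$. *)

theory Defs
  imports Complex_Main "Graph_Theory.Pair_Digraph" "Graph_Theory.Digraph_Isomorphism"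
begin

text \<open>
  Finite simple undirected graphs are the library's \<^locale>\<open>pair_graph\<close>s: finite vertex set and
  a symmetric, irreflexive set of arcs, each undirected edge \<open>uv\<close> being the two arcs
  \<open>(u, v)\<close> and \<open>(v, u)\<close>.
\<close>

definition neighbours :: "'a pair_pre_digraph \<Rightarrow> 'a \<Rightarrow> 'a set" where
  "neighbours G v = {u. (v, u) \<in> parcs G}"

definition regular_graph :: "nat \<Rightarrow> 'a pair_pre_digraph \<Rightarrow> bool" where
  "regular_graph k G \<longleftrightarrow> (\<forall>v\<in>pverts G. card (neighbours G v) = k)"

definition graph_iso :: "'a pair_pre_digraph \<Rightarrow> 'b pair_pre_digraph \<Rightarrow> bool" where
  "graph_iso G H \<longleftrightarrow> digraph_iso (with_proj G) (with_proj H)"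

text \<open>The values of \<open>f\<close> outside the vertex set are irrelevant.\<close>

definition PID_function :: "'a pair_pre_digraph \<Rightarrow> ('a \<Rightarrow> nat) \<Rightarrow> bool" where
  "PID_function G f \<longleftrightarrow>
     f \<in> pverts G \<rightarrow> {0, 1, 2} \<and>
     (\<forall>v\<in>pverts G. f v = 0 \<longrightarrow> (\<Sum>u\<in>neighbours G v. f u) = 2)"

definition weight :: "'a pair_pre_digraph \<Rightarrow> ('a \<Rightarrow> nat) \<Rightarrow> nat" where
  "weight G f = (\<Sum>v\<in>pverts G. f v)"

definition perfect_Italian_domination_number :: "'a pair_pre_digraph \<Rightarrow> nat" where
  "perfect_Italian_domination_number G = (LEAST w. \<exists>f. PID_function G f \<and> weight G f = w)"

lemma PID_function_const_1: "PID_function G (\<lambda>_. 1)"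
  by (simp add: PID_function_def)

lemma perfect_Italian_domination_number_attained:
  "\<exists>f. PID_function G f \<and> weight G f = perfect_Italian_domination_number G"
  unfolding perfect_Italian_domination_number_def
  by (rule LeastI_ex) (use PID_function_const_1 in blast)

lemma perfect_Italian_domination_number_le:
  "PID_function G f \<Longrightarrow> perfect_Italian_domination_number G \<le> weight G f"
  unfolding perfect_Italian_domination_number_def
  by (rule Least_le) blast

lemma graph_iso_bij:
  assumes "graph_iso G H"
  obtains h where "bij_betw h (pverts G) (pverts H)"
    and "\<And>u v. (u, v) \<in> parcs G \<Longrightarrow> (h u, h v) \<in> parcs H"
proof -
  from assms obtain f where f: "pre_digraph.digraph_isomorphism (with_proj G) f"
    and eq: "with_proj H = app_iso f (with_proj G)"
    by (auto simp: graph_iso_def digraph_iso_def)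
  from eq have H: "pverts H = iso_verts f ` pverts G" "parcs H = iso_arcs f ` parcs G"
    "iso_tail f = fst" "iso_head f = snd"
    by (simp_all add: with_proj_def app_iso_def)
  show thesis
  proof
    show "bij_betw (iso_verts f) (pverts G) (pverts H)"
      using f H by (simp add: pre_digraph.digraph_isomorphism_def bij_betw_def)
  next
    fix u v assume a: "(u, v) \<in> parcs G"
    then have "iso_arcs f (u, v) = (iso_verts f u, iso_verts f v)"
      using f H(3,4) by (force simp: pre_digraph.digraph_isomorphism_def intro: prod_eqI)
    then show "(iso_verts f u, iso_verts f v) \<in> parcs H"
      using a H(2) by (metis imageI)
  qed
qed

end

theory Submission
  imports Defs
begin

text \<open>
  Take disjoint copies of the complement of \<open>C\<^sub>5 + C\<^sub>m\<close>, where \<open>m = k - 2\<close>, so that a copy has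
  \<open>n = k + 3 \<ge> 8\<close> vertices. Suppose that a PID-function \<open>f\<close> of total weight \<open>W\<close> on a copy
  vanishes at some vertex. At each of its zeros the values at the two cyclic neighbours add up to
  \<open>W - 2\<close>; hence \<open>W \<le> 6\<close>, and double counting gives \<open>z (W - 2) \<le> 2 W\<close> for the number \<open>z\<close> of zeros.
  If \<open>W = 2\<close>, zeros propagate around the cycles, so one whole cycle is nonzero and \<open>W \<ge> 3\<close>, which
  is absurd. As there are at most \<open>W\<close> nonzero values, and at most 4 if \<open>W \<ge> 5\<close>, only \<open>W = 3\<close>, and \<open>W = 4\<close> with \<open>n = 8\<close>, are left; in
  both cases the 5-cycle carries weight at least 3, which leaves too little for the other cycle.
  So \<open>f\<close> has no zeros and its weight is at least the number of vertices.
\<close>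

section \<open>Weightings with a zero on a disjoint union of cycles\<close>

text \<open>\<open>s\<close> and \<open>p\<close> are the successor and predecessor in a union of
  cycles of length at least 3. Few values can be nonzero because the total is small, and few can be
  zero because each zero has heavy neighbours; together they must fill at least 8 places.\<close>

lemma zeros_of_cyclic_weighting:
  fixes f :: "'a \<Rightarrow> nat" and s p :: "'a \<Rightarrow> 'a"
  assumes A: "finite A" "card A \<ge> 8"
    and s: "\<And>x. x \<in> A \<Longrightarrow> s x \<in> A" and p: "\<And>x. x \<in> A \<Longrightarrow> p x \<in> A"
    and sp: "\<And>x. x \<in> A \<Longrightarrow> s (p x) = x" and ps: "\<And>x. x \<in> A \<Longrightarrow> p (s x) = x"
    and ne: "\<And>x. x \<in> A \<Longrightarrow> s x \<noteq> x" "\<And>x. x \<in> A \<Longrightarrow> s x \<noteq> p x"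
    and f: "\<And>x. x \<in> A \<Longrightarrow> f x \<le> 2"
    and zero: "\<And>x. x \<in> A \<Longrightarrow> f x = 0 \<Longrightarrow> f (s x) + f (p x) + 2 = sum f A"
    and ex: "r \<in> A" "f r = 0"
  shows "sum f A = 3 \<or> (sum f A = 4 \<and> card A = 8)"
proof -
  define W where "W = sum f A"
  define Z where "Z = {x \<in> A. f x = 0}"
  define N where "N = {x \<in> A. f x \<noteq> 0}"
  have fin: "finite Z" "finite N" using A by (auto simp: Z_def N_def)
  have AZN: "A = Z \<union> N" "Z \<inter> N = {}" by (auto simp: Z_def N_def)
  have cA: "card A = card Z + card N" using fin AZN by (simp add: card_Un_disjoint)
  have WN: "W = sum f N"
    unfolding W_def N_def using A by (intro sum.mono_neutral_right) auto
  have NW: "card N \<le> W"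
    unfolding WN card_eq_sum by (rule sum_mono) (auto simp: N_def)
  have bs: "bij_betw s A A" using s p sp ps by (intro bij_betw_byWitness[where f' = p]) auto
  have bp: "bij_betw p A A" using s p sp ps by (intro bij_betw_byWitness[where f' = s]) auto
  have "card Z * (W - 2) = (\<Sum>x\<in>Z. f (s x) + f (p x))"
  proof -
    have "f (s x) + f (p x) = W - 2" if "x \<in> Z" for x
      using zero[of x] that by (simp add: Z_def W_def)
    then show ?thesis by simp
  qed
  also have "\<dots> \<le> (\<Sum>x\<in>A. f (s x) + f (p x))"
    using A by (intro sum_mono2) (auto simp: Z_def)
  \<comment> \<open>\<open>s\<close> and \<open>p\<close> permute \<open>A\<close>, so every value
    is counted twice.\<close>
  also have "\<dots> = 2 * W"
    using sum.reindex_bij_betw[OF bs, of f] sum.reindex_bij_betw[OF bp, of f]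
    by (simp add: sum.distrib W_def)
  finally have count: "card Z * (W - 2) \<le> 2 * W" .
  have Wr: "W = f (s r) + f (p r) + 2" using zero[OF ex] by (simp add: W_def)
  have W6: "W \<le> 6" using Wr f[OF s[OF ex(1)]] f[OF p[OF ex(1)]] by simp
  have W2: "W \<noteq> 2"
  proof
    assume W: "W = 2"
    \<comment> \<open>Both cyclic neighbours of a zero are now zeros. So \<open>N\<close> is closed
      under \<open>s\<close> and contains three distinct points \<open>x\<close>,
      \<open>s x\<close>, \<open>s (s x)\<close>.\<close>
    have cl: "s x \<in> N" if "x \<in> N" for x
    proof (rule ccontr)
      assume "s x \<notin> N"
      with that have "x \<in> A" "f (s x) = 0" "s x \<in> A" using s by (auto simp: N_def)
      then have "f x = 0" using zero[of "s x"] W ps by (simp add: W_def)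
      with that show False by (simp add: N_def)
    qed
    have "N \<noteq> {}" using W WN by auto
    then obtain x where x: "x \<in> N" by auto
    then have xA: "x \<in> A" by (simp add: N_def)
    have "card {x, s x, s (s x)} \<le> card N"
      using x cl fin by (intro card_mono) auto
    moreover have "s (s x) \<noteq> x" using ne(2)[OF s[OF xA]] ne(2)[OF xA] ps[OF s[OF xA]] by metis
    then have "card {x, s x, s (s x)} = 3"
      using ne(1)[OF xA] ne(1)[OF s[OF xA]] by auto
    ultimately show False using NW W by simp
  qed
  \<comment> \<open>The two values next to \<open>r\<close> add up to \<open>W - 2\<close>, so at
    least one of them is 2, and both are if \<open>W = 6\<close>. Each value 2 lowers the bound
    \<open>card N \<le> W\<close> by one.\<close>
  have N4: "card N \<le> 4" if "W \<ge> 5"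
  proof -
    have "f (s r) = 2 \<or> f (p r) = 2"
      using Wr that f[OF s[OF ex(1)]] f[OF p[OF ex(1)]] by linarith
    then obtain y where y: "y \<in> {s r, p r}" "f y = 2" by blast
    show ?thesis
    proof (cases "W = 5")
      case True
      have yN: "y \<in> N" using y s p ex by (auto simp: N_def)
      have "card (N - {y}) \<le> sum f (N - {y})"
        unfolding card_eq_sum by (rule sum_mono) (auto simp: N_def)
      moreover have "W = f y + sum f (N - {y})" unfolding WN using fin yN by (intro sum.remove)
      moreover have "card N = Suc (card (N - {y}))"
        using fin yN by (simp only: card_Suc_Diff1)
      ultimately show ?thesis using True y by simp
    next
      case False
      then have 6: "f (s r) = 2" "f (p r) = 2" "W = 6"
        using W6 Wr that f[OF s[OF ex(1)]] f[OF p[OF ex(1)]] by auto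
      let ?M = "N - {s r, p r}"
      have sub: "{s r, p r} \<subseteq> N" using 6 s p ex by (auto simp: N_def)
      have "card ?M \<le> sum f ?M"
        unfolding card_eq_sum by (rule sum_mono) (auto simp: N_def)
      moreover have "W = sum f ?M + sum f {s r, p r}"
        unfolding WN using sub fin by (intro sum.subset_diff)
      moreover have "card ?M = card N - 2" using sub ne(2)[OF ex(1)] fin
        by (subst card_Diff_subset) auto
      ultimately show ?thesis using 6 ne(2)[OF ex(1)] by simp
    qed
  qed
  \<comment> \<open>By \<open>count\<close> there are at most 4 zeros if \<open>W = 4\<close>, and
    at most 3 if \<open>W\<close> is 5 or 6. With at most 4 nonzero values this allows 8 points in
    the first case and only 7 in the others.\<close>
  consider "W = 3" | "W = 4" | "W = 5" | "W = 6" using W6 W2 Wr by linarith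
  then show ?thesis
  proof cases
    case 2
    then show ?thesis using count cA A NW by (simp add: W_def)
  next
    case 3
    then show ?thesis using count cA A N4 by simp
  next
    case 4
    then show ?thesis using count cA A N4 by simp
  qed (simp add: W_def)
qed

text \<open>Let \<open>a = 0\<close>, so that its neighbours carry \<open>w\<close>. If
  \<open>w = 2\<close>, then \<open>c\<close> and \<open>d\<close> cannot both vanish, as this would
  force \<open>b = e = 2\<close>. If \<open>w = 1\<close>, one neighbour of \<open>a\<close> is 0,
  so its other neighbour is 1; the remaining vertex lies between two values 1 and is thus
  nonzero.\<close>

lemma five_cycle_weight_ge_3:
  fixes a b c d e w :: nat
  assumes "a = 0 \<Longrightarrow> b + e = w" "b = 0 \<Longrightarrow> c + a = w" "c = 0 \<Longrightarrow> d + b = w"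
    "d = 0 \<Longrightarrow> e + c = w" "e = 0 \<Longrightarrow> a + d = w" and w: "w = 1 \<or> w = 2"
  shows "a + b + c + d + e \<ge> 3"
  using w assms(1-5)
  by (elim disjE; cases "a = 0"; cases "b = 0"; cases "c = 0"; cases "d = 0"; cases "e = 0"; simp)

section \<open>A single copy\<close>

text \<open>Successor and predecessor in the cycles on \<open>{0..4}\<close> and on \<open>{5..<n}\<close>.\<close>

definition cyc_succ :: "nat \<Rightarrow> nat \<Rightarrow> nat" where
  "cyc_succ n r = (if r = 4 then 0 else if Suc r = n then 5 else Suc r)"

definition cyc_pred :: "nat \<Rightarrow> nat \<Rightarrow> nat" where
  "cyc_pred n r = (if r = 0 then 4 else if r = 5 then n - 1 else r - 1)"

text \<open>This is the closed neighbourhood of \<open>r\<close> in the union of the two cycles.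
  Including \<open>r\<close> itself excludes loops in the complement.\<close>

definition non_adjacent :: "nat \<Rightarrow> nat \<Rightarrow> nat set" where
  "non_adjacent n r = {r, cyc_succ n r, cyc_pred n r}"

context
  fixes n :: nat
  assumes n: "n \<ge> 8"
begin

lemma cyc_simps:
  assumes "r < n"
  shows "cyc_succ n r < n" "cyc_pred n r < n"
    "cyc_succ n (cyc_pred n r) = r" "cyc_pred n (cyc_succ n r) = r"
    "cyc_succ n r \<noteq> r" "cyc_pred n r \<noteq> r" "cyc_succ n r \<noteq> cyc_pred n r"
  using n assms by (auto simp: cyc_succ_def cyc_pred_def split: if_splits)

lemma non_adjacent_sym: "r < n \<Longrightarrow> t < n \<Longrightarrow> t \<in> non_adjacent n r \<longleftrightarrow> r \<in> non_adjacent n t"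
  using cyc_simps(3,4) by (auto simp: non_adjacent_def)

lemma card_non_adjacent: "r < n \<Longrightarrow> card (non_adjacent n r) = 3"
  using cyc_simps[of r] by (auto simp: non_adjacent_def)

lemma copy_weight_ge:
  fixes f :: "nat \<Rightarrow> nat"
  assumes f: "\<And>r. r < n \<Longrightarrow> f r \<le> 2"
    and pid: "\<And>r. r < n \<Longrightarrow> f r = 0 \<Longrightarrow> sum f ({..<n} - non_adjacent n r) = 2"
  shows "n \<le> sum f {..<n}"
proof (cases "\<exists>r<n. f r = 0")
  case False
  then have "(\<Sum>r<n. 1) \<le> sum f {..<n}" by (intro sum_mono) (auto simp: Suc_le_eq)
  then show ?thesis by simp
next
  case True
  then obtain r where r: "r < n" "f r = 0" by auto
  have zero: "f (cyc_succ n x) + f (cyc_pred n x) + 2 = sum f {..<n}" if x: "x < n" "f x = 0" for x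
  proof -
    have "sum f {..<n} = sum f ({..<n} - non_adjacent n x) + sum f (non_adjacent n x)"
      using cyc_simps(1,2)[OF x(1)] x by (intro sum.subset_diff) (auto simp: non_adjacent_def)
    moreover have "sum f (non_adjacent n x) = f (cyc_succ n x) + f (cyc_pred n x)"
      using cyc_simps(5-7)[OF x(1)] x by (auto simp: non_adjacent_def)
    ultimately show ?thesis using pid[OF x] by simp
  qed
  have W: "sum f {..<n} = 3 \<or> sum f {..<n} = 4 \<and> card {..<n} = 8"
    by (rule zeros_of_cyclic_weighting[where s = "cyc_succ n" and p = "cyc_pred n" and r = r])
      (use n f zero r cyc_simps in auto)
  define w where "w = sum f {..<n} - 2"
  have w: "f (cyc_succ n x) + f (cyc_pred n x) = w" if "x < n" "f x = 0" for x
    using zero[OF that] by (simp add: w_def)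
  have five: "f 0 + f 1 + f 2 + f 3 + f 4 \<ge> 3"
    using n W w[of 0] w[of 1] w[of 2] w[of 3] w[of 4]
    by (intro five_cycle_weight_ge_3[of _ _ _ w])
      (auto simp: cyc_succ_def cyc_pred_def w_def numeral_eq_Suc)
  have split: "sum f {..<n} = (f 0 + f 1 + f 2 + f 3 + f 4) + sum f {5..<n}"
  proof -
    have "sum f {..<n} = sum f {..<5} + sum f {5..<n}"
      using n by (simp add: atLeast0LessThan[symmetric] sum.atLeastLessThan_concat)
    then show ?thesis by (simp add: numeral_eq_Suc)
  qed
  from W show ?thesis
  proof
    assume 3: "sum f {..<n} = 3"
    then have "sum f {5..<n} = 0" using five split by linarith
    \<comment> \<open>The zero at 5 has only zeros beside it, although they should carry
      \<open>w = 1\<close>.\<close>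
    then have "f 5 = 0" "f 6 = 0" "f (n - 1) = 0" using n by auto
    with w[of 5] n 3 show ?thesis by (simp add: cyc_succ_def cyc_pred_def w_def)
  next
    assume 4: "sum f {..<n} = 4 \<and> card {..<n} = 8"
    \<comment> \<open>The second cycle is the triangle 5, 6, 7. A zero at 5 or 6 would put weight 2
      on the other two vertices, and two nonzero values there also exceed 1.\<close>
    then have n8: "n = 8" by simp
    then have "sum f {5..<n} = f 5 + f 6 + f 7"
      by (simp add: numeral_eq_Suc)
    then have "f 5 + f 6 + f 7 \<le> 1" using five split 4 by linarith
    moreover have "f 5 = 0 \<Longrightarrow> f 6 + f 7 = 2" "f 6 = 0 \<Longrightarrow> f 7 + f 5 = 2"
      using w[of 5] w[of 6] n8 4 by (simp_all add: cyc_succ_def cyc_pred_def w_def)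
    ultimately show ?thesis by linarith
  qed
qed

section \<open>Disjoint copies\<close>

text \<open>The number \<open>q * n + r\<close> encodes vertex \<open>r\<close> of copy
  \<open>q\<close>, which keeps all members of the family over the type \<open>nat\<close>.\<close>

definition copies :: "nat \<Rightarrow> nat pair_pre_digraph" where
  "copies m = \<lparr>pverts = {..<m * n},
     parcs = {(u, v). u < m * n \<and> v < m * n \<and> u div n = v div n \<and>
       v mod n \<notin> non_adjacent n (u mod n)}\<rparr>"

lemma copy_index: "q < m \<Longrightarrow> r < n \<Longrightarrow> q * n + r < m * n"
  using mult_le_mono1[of "Suc q" m n] by simp

lemma pair_graph_copies: "pair_graph (copies m)"
proof
  show "finite (pverts (copies m))" by (simp add: copies_def)
  show "finite (parcs (copies m))"
    by (rule finite_subset[of _ "{..<m * n} \<times> {..<m * n}"]) (auto simp: copies_def)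
  show "symmetric (with_proj (copies m))"
    using non_adjacent_sym n
    by (auto simp: symmetric_def arcs_ends_def arc_to_ends_def copies_def intro!: symI)
qed (auto simp: copies_def non_adjacent_def)

lemma neighbours_copies:
  assumes "q < m" "r < n"
  shows "neighbours (copies m) (q * n + r) = (\<lambda>t. q * n + t) ` ({..<n} - non_adjacent n r)"
    (is "?L = ?R")
proof
  show "?R \<subseteq> ?L"
    using assms copy_index by (auto simp: neighbours_def copies_def)
  show "?L \<subseteq> ?R"
  proof
    fix u assume "u \<in> ?L"
    then have "u div n = q" "u mod n \<notin> non_adjacent n r"
      using assms by (auto simp: neighbours_def copies_def)
    moreover have "u mod n < n" using n by simp
    ultimately show "u \<in> ?R" by (metis (no_types) DiffI div_mult_mod_eq image_eqI lessThan_iff)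
  qed
qed

lemma vertex_of_copies:
  assumes "v < m * n"
  obtains q r where "q < m" "r < n" "v = q * n + r"
  using assms n by (metis bot_nat_0.extremum_strict div_mult_mod_eq less_mult_imp_div_less mod_less_divisor mult_0_right not_gr_zero)

lemma regular_copies: "regular_graph (n - 3) (copies m)"
  unfolding regular_graph_def
proof
  fix v assume "v \<in> pverts (copies m)"
  then have "v < m * n" by (simp add: copies_def)
  then obtain q r where v: "q < m" "r < n" "v = q * n + r" by (rule vertex_of_copies)
  have "card ({..<n} - non_adjacent n r) = card {..<n} - 3"
    using card_non_adjacent[of r] cyc_simps(1,2)[of r] v
    by (subst card_Diff_subset) (auto simp: non_adjacent_def)
  then show "card (neighbours (copies m) v) = n - 3"
    using v by (simp add: neighbours_copies card_image inj_on_def)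
qed

lemma weight_copies_ge:
  assumes f: "PID_function (copies m) f"
  shows "m * n \<le> weight (copies m) f"
proof -
  have "m * n = (\<Sum>q<m. n)" by simp
  also have "\<dots> \<le> (\<Sum>q<m. \<Sum>r<n. f (q * n + r))"
  \<comment> \<open>Neighbourhoods stay inside a copy, so the domination condition restricts to each
    block of \<open>n\<close> numbers.\<close>
  proof (intro sum_mono copy_weight_ge)
    fix q r assume q: "q \<in> {..<m}" and r: "r < n"
    then have v: "q * n + r \<in> pverts (copies m)" using copy_index by (simp add: copies_def)
    then have "f (q * n + r) \<in> {0, 1, 2}" using f unfolding PID_function_def by (blast dest: Pi_mem)
    then show "f (q * n + r) \<le> 2" by auto
    assume "f (q * n + r) = 0"
    then have "sum f (neighbours (copies m) (q * n + r)) = 2"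
      using f v by (simp add: PID_function_def)
    then show "(\<Sum>t\<in>{..<n} - non_adjacent n r. f (q * n + t)) = 2"
      using q r by (simp add: neighbours_copies sum.reindex)
  qed
  also have "\<dots> = weight (copies m) f"
    using sum.nat_group[of f n m] by (simp add: weight_def copies_def sum.atLeastLessThan_shift_0 atLeast0LessThan)
  finally show ?thesis .
qed

lemma perfect_Italian_domination_number_copies:
  "perfect_Italian_domination_number (copies m) = card (pverts (copies m))"
proof (rule antisym)
  have "perfect_Italian_domination_number (copies m) \<le> weight (copies m) (\<lambda>_. 1)"
    by (intro perfect_Italian_domination_number_le PID_function_const_1)
  then show "perfect_Italian_domination_number (copies m) \<le> card (pverts (copies m))"
    by (simp add: weight_def)
  show "card (pverts (copies m)) \<le> perfect_Italian_domination_number (copies m)"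
  proof -
    obtain f where f: "PID_function (copies m) f"
      "weight (copies m) f = perfect_Italian_domination_number (copies m)"
      using perfect_Italian_domination_number_attained by blast
    have "card (pverts (copies m)) = m * n" by (simp add: copies_def)
    then show ?thesis using weight_copies_ge[OF f(1)] f(2) by simp
  qed
qed

lemma graph_iso_copies_imp_eq:
  assumes "graph_iso (copies m) (copies m')"
  shows "m = m'"
proof -
  obtain h where "bij_betw h (pverts (copies m)) (pverts (copies m'))"
    using graph_iso_bij[OF assms] by blast
  then have "card (pverts (copies m)) = card (pverts (copies m'))" by (rule bij_betw_same_card)
  then show ?thesis using n by (simp add: copies_def)
qed

lemma inj_copies: "inj copies"
proof (rule injI)
  fix m m' assume "copies m = copies m'"
  then have "card (pverts (copies m)) = card (pverts (copies m'))" by simp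
  then show "m = m'" using n by (simp add: copies_def)
qed

end

theorem theorem32:
  fixes k :: nat
  assumes "k \<ge> 5"
  shows "\<exists>\<G> :: nat pair_pre_digraph set.
    infinite \<G> \<and>
    (\<forall>G\<in>\<G>. \<forall>H\<in>\<G>. G \<noteq> H \<longrightarrow> \<not> graph_iso G H) \<and>
    (\<forall>G\<in>\<G>. pair_graph G \<and> pverts G \<noteq> {} \<and> regular_graph k G) \<and>
    (\<forall>G\<in>\<G>. perfect_Italian_domination_number G = card (pverts G)) \<and>
    (\<forall>G\<in>\<G>. real (perfect_Italian_domination_number G) \<le> 1 * real (card (pverts G))) \<and>
    (\<forall>c::real. (\<forall>G\<in>\<G>. real (perfect_Italian_domination_number G) \<le> c * real (card (pverts G)))
       \<longrightarrow> 1 \<le> c)"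
proof -
  \<comment> \<open>Each vertex misses exactly itself and its two cyclic neighbours in its copy, so
    degree \<open>k\<close> needs \<open>k + 3\<close> vertices.\<close>
  define n where "n = k + 3"
  have n: "n \<ge> 8" using assms by (simp add: n_def)
  define \<G> where "\<G> = copies n ` {1..}"
  have "infinite \<G>"
    unfolding \<G>_def using inj_copies[OF n] infinite_Ici[of "1::nat"]
    by (metis finite_imageD inj_on_subset subset_UNIV)
  moreover have "\<forall>G\<in>\<G>. \<forall>H\<in>\<G>. G \<noteq> H \<longrightarrow> \<not> graph_iso G H"
    unfolding \<G>_def using graph_iso_copies_imp_eq[OF n] by auto
  moreover have "\<forall>G\<in>\<G>. pair_graph G \<and> pverts G \<noteq> {} \<and> regular_graph k G"
  proof
    fix G assume "G \<in> \<G>"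
    then obtain m where m: "m \<ge> 1" "G = copies n m" by (auto simp: \<G>_def)
    then have "pverts G = {..<m * n}" by (simp add: copies_def[OF n])
    moreover have "0 < m * n" using m n by simp
    ultimately have "pverts G \<noteq> {}" by blast
    moreover have "regular_graph k G" using regular_copies[OF n, of m] m by (simp add: n_def)
    ultimately show "pair_graph G \<and> pverts G \<noteq> {} \<and> regular_graph k G"
      using pair_graph_copies[OF n] m by simp
  qed
  moreover have eq: "\<forall>G\<in>\<G>. perfect_Italian_domination_number G = card (pverts G)"
    unfolding \<G>_def using perfect_Italian_domination_number_copies[OF n] by auto
  moreover have "1 \<le> c"
    if c: "\<forall>G\<in>\<G>. real (perfect_Italian_domination_number G) \<le> c * real (card (pverts G))" for c
  proof -
    \<comment> \<open>A single copy already forces the constant to be at least 1.\<close>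
    have G: "copies n 1 \<in> \<G>" by (simp add: \<G>_def)
    have "real n \<le> c * real n"
      using c[rule_format, OF G] eq[rule_format, OF G] by (simp add: copies_def[OF n])
    then show ?thesis using n by simp
  qed
  ultimately show ?thesis by (intro exI[of _ \<G>]) simp
qed

end
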